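(* (i) Let $a,b,c\in\mathbb{C}$, so that $[1,a,b,c]$ is an arbitrary point of $\mathbb{C}P^3$ outside the face $\mathcal{F}_0=\{[z^0,z^1,z^2,z^3]: z^0=0\}$, and put $x=1+|a|^2+|b|^2+|c|^2$. Let $I\in\mathcal{Z}$ be the left-invariant orthogonal almost complex structure corresponding to this point. Then $I$ lies in the neighbourhood $$U(I_0)=\{I\in\mathcal{Z}: 1-II_0 \text{ is invertible}\}$$ of $I_0$, and its matrix $(I_{ij})_{i,j=1}^6$ in the basis $(e)$, $I_{ij}=g(Ie_i,e_j)$, is the skew-symmetric matrix with $$\begin{array}{lll} I_{12}=\frac{2}{x}\,\mathrm{Im}(\bar a b+c), & I_{13}=\frac{2}{x}\,\mathrm{Im}(\bar a c-b), & I_{23}=\frac{2}{x}\,\mathrm{Im}(\bar b c+a),\\ I_{14}=\frac{1}{x}(x-2|b|^2-2|c|^2), & I_{15}=\frac{2}{x}\,\mathrm{Re}(\bar a b-c), & I_{16}=\frac{2}{x}\,\mathrm{Re}(\bar a c+b),\\ I_{24}=\frac{2}{x}\,\mathrm{Re}(\bar a b+c), & I_{25}=\frac{1}{x}(x-2|a|^2-2|c|^2), & I_{26}=\frac{2}{x}\,\mathrm{Re}(\bar b c-a),\\ I_{34}=\frac{2}{x}\,\mathrm{Re}(\bar a c-b), & I_{35}=\frac{2}{x}\,\mathrm{Re}(\bar b c+a), & I_{36}=\frac{1}{x}(x-2|a|^2-2|b|^2),\\ I_{45}=\frac{2}{x}\,\mathrm{Im}(\bar a b-c), & I_{46}=\frac{2}{x}\,\mathrm{Im}(\bar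 a c+b), & I_{56}=\frac{2}{x}\,\mathrm{Im}(\bar b c-a), \end{array}$$ and $I_{ji}=-I_{ij}$, $I_{ii}=0$. (ii) Conversely, let $I$ be an arbitrary almost complex structure in $U(I_0)$, with matrix $(I_{ij})_{i,j=1}^6$ in the basis $(e)$, $I_{ij}=g(Ie_i,e_j)$. Then the corresponding point of $\mathbb{C}P^3$ is $[1,a,b,c]$ with $$a=\frac{(I_{35}-I_{26})+i(I_{23}-I_{56})}{1+I_{14}+I_{25}+I_{36}},\quad b=\frac{(I_{16}-I_{34})+i(I_{46}-I_{13})}{1+I_{14}+I_{25}+I_{36}},\quad c=\frac{(I_{24}-I_{15})+i(I_{12}-I_{45})}{1+I_{14}+I_{25}+I_{36}}.$$
   Context: Let $G$ be a 6-dimensional Lie group with Lie algebra $\mathfrak{g}$ and a left-invariant Riemannian metric $g$. Left-invariant almost complex structures on $G$ are identified with endomorphisms $I$ of $\mathfrak{g}$ with $I^2=-1$; $I$ is orthogonal if $g(IX,IY)=g(X,Y)$. Fix a $g$-orthonormal basis $(e)=(e_1,\dots,e_6)$ of $\mathfrak{g}$ with dual basis $(e^1,\dots,e^6)$. Let $I_0$ be given by $I_0e_1=e_4$, $I_0e_2=e_5$, $I_0e_3=e_6$ (and $I_0^2=-1$). Let $\mathcal{Z}=\{SI_0S^{-1}: S\in SO(6)\}$ be the set of orthogonal almost complex structures inducing the same orientation as $I_0$; thus $\mathcal{Z}=SO(6)/U(3)$. An endomorphism $I$ acts on (complex) covectors by $(I\alpha)(X)=\alpha(IX)$ (so $I_0e^1=-e^4$,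 etc.), and $\mathfrak{g}^{*1,0}=\{\alpha\in\mathfrak{g}^*\otimes\mathbb{C}: I\alpha=i\alpha\}$. Correspondence $\mathcal{Z}\leftrightarrow\mathbb{C}P^3$: let $V=\mathbb{C}^4$ with unitary basis $(v^0,v^1,v^2,v^3)$, and identify $\Lambda^2V$ with $\mathfrak{g}^*\otimes\mathbb{C}$ by $$2v^0\wedge v^1=e^1+ie^4,\quad 2v^0\wedge v^2=e^2+ie^5,\quad 2v^0\wedge v^3=e^3+ie^6,$$ $$2v^2\wedge v^3=e^1-ie^4,\quad 2v^3\wedge v^1=e^2-ie^5,\quad 2v^1\wedge v^2=e^3-ie^6.$$ For $0\ne u\in V$ let $V_u=\{u\wedge v: v\in V\}\subset\Lambda^2V$. Each $I\in\mathcal{Z}$ corresponds to the unique point $[u]\in\mathbb{C}P^3$ such that $\mathfrak{g}^{*1,0}=V_u$, and this is a bijection $\mathcal{Z}\to\mathbb{C}P^3$. The point $[z^0,z^1,z^2,z^3]$ denotes the class of $u=z^0v^0+z^1v^1+z^2v^2+z^3v^3$; in particular $I_0$ corresponds to $[1,0,0,0]$. *)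

theory Defs
  imports "HOL-Analysis.Analysis"
begin

text \<open>
  A Lie group with a left-invariant metric enters through its Lie algebra, a type of class
  \<^class>\<open>euclidean_space\<close> whose inner product is the metric, together with a bracket.
  Frames are indexed by the numeral type \<open>6\<close>, whose elements are \<open>1, 2, 3, 4, 5, 6\<close> (with
  \<open>6 = 0\<close>); the unitary basis of \<open>V = complex^4\<close> is indexed by \<open>0, 1, 2, 3\<close> in the numeral
  type \<open>4\<close>.
\<close>

definition lie_bracket :: "('a::real_vector \<Rightarrow> 'a \<Rightarrow> 'a) \<Rightarrow> bool" where
  "lie_bracket br \<longleftrightarrow> bilinear br \<and> (\<forall>X. br X X = 0) \<and>
     (\<forall>X Y Z. br X (br Y Z) + br Y (br Z X) + br Z (br X Y) = 0)"

definition orthonormal_frame :: "(6 \<Rightarrow> 'a::euclidean_space) \<Rightarrow> bool" where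
  "orthonormal_frame e \<longleftrightarrow>
     (\<forall>i j. e i \<bullet> e j = (if i = j then 1 else 0)) \<and> span (range e) = UNIV"

definition std_acs :: "(6 \<Rightarrow> 'a::euclidean_space) \<Rightarrow> 'a \<Rightarrow> 'a" where
  "std_acs e X =
     (X \<bullet> e 1) *\<^sub>R e 4 + (X \<bullet> e 2) *\<^sub>R e 5 + (X \<bullet> e 3) *\<^sub>R e 6
     - (X \<bullet> e 4) *\<^sub>R e 1 - (X \<bullet> e 5) *\<^sub>R e 2 - (X \<bullet> e 6) *\<^sub>R e 3"

definition SO_frame :: "(6 \<Rightarrow> 'a::euclidean_space) \<Rightarrow> ('a \<Rightarrow> 'a) set" where
  "SO_frame e = {S. orthogonal_transformation S \<and>
     det ((\<chi> i j. S (e j) \<bullet> e i) :: real^6^6) = 1}"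

definition acs_space :: "(6 \<Rightarrow> 'a::euclidean_space) \<Rightarrow> ('a \<Rightarrow> 'a) set" where
  "acs_space e = {S \<circ> std_acs e \<circ> inv S | S. S \<in> SO_frame e}"

definition acs_nbhd :: "(6 \<Rightarrow> 'a::euclidean_space) \<Rightarrow> ('a \<Rightarrow> 'a) set" where
  "acs_nbhd e = {I \<in> acs_space e. bij (\<lambda>X. X - I (std_acs e X))}"

definition acs_entry :: "(6 \<Rightarrow> 'a::euclidean_space) \<Rightarrow> ('a \<Rightarrow> 'a) \<Rightarrow> 6 \<Rightarrow> 6 \<Rightarrow> real" where
  "acs_entry e I i j = I (e i) \<bullet> e j"

text \<open>
  The complexified dual is the space of real-linear maps into the complex numbers.
  For an orthonormal frame, the dual basis consists of the coordinate functions below.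
\<close>

definition dual_covector :: "(6 \<Rightarrow> 'a::euclidean_space) \<Rightarrow> 6 \<Rightarrow> 'a \<Rightarrow> complex" where
  "dual_covector e i X = complex_of_real (X \<bullet> e i)"

definition covectors10 :: "('a::euclidean_space \<Rightarrow> 'a) \<Rightarrow> ('a \<Rightarrow> complex) set" where
  "covectors10 I = {\<alpha>. linear \<alpha> \<and> (\<forall>X. \<alpha> (I X) = \<i> * \<alpha> X)}"

definition vbasis :: "4 \<Rightarrow> complex^4" where
  "vbasis k = axis k 1"

text \<open>
  The second exterior power of \<open>V\<close> is realised as the space of skew-symmetric 4 by 4 matrices,
  with \<open>u \<and> v = u \<otimes> v - v \<otimes> u\<close>.  On that space \<open>lambda2_covector e\<close> is the complex-linear
  map prescribed on the basis \<open>v\<^sup>0\<and>v\<^sup>1, v\<^sup>0\<and>v\<^sup>2, v\<^sup>0\<and>v\<^sup>3, v\<^sup>2\<and>v\<^sup>3, v\<^sup>3\<and>v\<^sup>1, v\<^sup>1\<and>v\<^sup>2\<close>, the coordinates of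
  \<open>w\<close> in this basis being the entries of \<open>w\<close> at the corresponding positions; see
  \<open>lambda2_covector_basis\<close>.
\<close>

definition wedge :: "complex^4 \<Rightarrow> complex^4 \<Rightarrow> complex^4^4" where
  "wedge u v = (\<chi> i j. u $ i * v $ j - v $ i * u $ j)"

definition lambda2_covector ::
    "(6 \<Rightarrow> 'a::euclidean_space) \<Rightarrow> complex^4^4 \<Rightarrow> 'a \<Rightarrow> complex" where
  "lambda2_covector e w X =
     w $ 0 $ 1 * (dual_covector e 1 X + \<i> * dual_covector e 4 X) / 2
   + w $ 0 $ 2 * (dual_covector e 2 X + \<i> * dual_covector e 5 X) / 2
   + w $ 0 $ 3 * (dual_covector e 3 X + \<i> * dual_covector e 6 X) / 2
   + w $ 2 $ 3 * (dual_covector e 1 X - \<i> * dual_covector e 4 X) / 2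
   + w $ 3 $ 1 * (dual_covector e 2 X - \<i> * dual_covector e 5 X) / 2
   + w $ 1 $ 2 * (dual_covector e 3 X - \<i> * dual_covector e 6 X) / 2"

definition Vspace :: "(6 \<Rightarrow> 'a::euclidean_space) \<Rightarrow> complex^4 \<Rightarrow> ('a \<Rightarrow> complex) set" where
  "Vspace e u = {lambda2_covector e (wedge u v) | v. True}"

definition proj_class :: "complex^4 \<Rightarrow> (complex^4) set" where
  "proj_class u = {k *s u | k. k \<noteq> 0}"

definition CP3 :: "(complex^4) set set" where
  "CP3 = {proj_class u | u. u \<noteq> 0}"

definition hpoint :: "complex \<Rightarrow> complex \<Rightarrow> complex \<Rightarrow> complex \<Rightarrow> (complex^4) set" where
  "hpoint z0 z1 z2 z3 =
     proj_class (z0 *s vbasis 0 + z1 *s vbasis 1 + z2 *s vbasis 2 + z3 *s vbasis 3)"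

definition face0 :: "(complex^4) set set" where
  "face0 = {hpoint z0 z1 z2 z3 | z0 z1 z2 z3. (z0, z1, z2, z3) \<noteq> (0, 0, 0, 0) \<and> z0 = 0}"

text \<open>
  The correspondence is a relation; its two directions are definite descriptions, so that a
  statement about \<open>acs_of_point e p\<close> or \<open>point_of_acs e I\<close> has content only when the
  corresponding object exists and is unique.
\<close>

definition corresponds ::
    "(6 \<Rightarrow> 'a::euclidean_space) \<Rightarrow> ('a \<Rightarrow> 'a) \<Rightarrow> (complex^4) set \<Rightarrow> bool" where
  "corresponds e I p \<longleftrightarrow> (\<exists>u. u \<noteq> 0 \<and> p = proj_class u \<and> covectors10 I = Vspace e u)"

definition acs_of_point :: "(6 \<Rightarrow> 'a::euclidean_space) \<Rightarrow> (complex^4) set \<Rightarrow> 'a \<Rightarrow> 'a" where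
  "acs_of_point e p = (THE I. I \<in> acs_space e \<and> corresponds e I p)"

definition point_of_acs :: "(6 \<Rightarrow> 'a::euclidean_space) \<Rightarrow> ('a \<Rightarrow> 'a) \<Rightarrow> (complex^4) set" where
  "point_of_acs e I = (THE p. p \<in> CP3 \<and> corresponds e I p)"

lemma std_acs_frame:
  assumes "orthonormal_frame e"
  shows "std_acs e (e 1) = e 4" "std_acs e (e 2) = e 5" "std_acs e (e 3) = e 6"
    "std_acs e (e 4) = - e 1" "std_acs e (e 5) = - e 2" "std_acs e (e 6) = - e 3"
  using assms by (simp_all add: std_acs_def orthonormal_frame_def)

lemma linear_std_acs: "linear (std_acs e)"
  by (rule linearI) (simp_all add: std_acs_def algebra_simps inner_add_left)

lemma std_acs_square:
  assumes "orthonormal_frame e"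
  shows "std_acs e (std_acs e X) = - X"
proof -
  have all6: "i \<in> {1,2,3,4,5,6}" for i :: 6
  proof -
    have "card {1,2,3,4,5,6::6} = CARD(6)" by simp
    then have "{1,2,3,4,5,6::6} = UNIV"
      by (metis card_subset_eq finite_UNIV finite subset_UNIV)
    then show ?thesis by simp
  qed
  have lin: "linear (\<lambda>X. std_acs e (std_acs e X))" "linear (\<lambda>X::'a. - X)"
    using linear_compose[OF linear_std_acs linear_std_acs, of e e]
    by (simp_all add: o_def linear_uminus module_hom_uminus)
  have "std_acs e (std_acs e (e i)) = - e i" for i
    using all6[of i]
    by (auto simp: std_acs_frame[OF assms] linear_neg[OF linear_std_acs])
  then show ?thesis
    using linear_eq_on_span[OF lin, of "range e" X] assms
    by (auto simp: orthonormal_frame_def)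
qed

lemma dual_covector_frame:
  assumes "orthonormal_frame e"
  shows "dual_covector e i (e j) = (if i = j then 1 else 0)"
  using assms by (auto simp: dual_covector_def orthonormal_frame_def)

lemma lambda2_covector_basis:
  "2 * lambda2_covector e (wedge (vbasis 0) (vbasis 1)) X = dual_covector e 1 X + \<i> * dual_covector e 4 X"
  "2 * lambda2_covector e (wedge (vbasis 0) (vbasis 2)) X = dual_covector e 2 X + \<i> * dual_covector e 5 X"
  "2 * lambda2_covector e (wedge (vbasis 0) (vbasis 3)) X = dual_covector e 3 X + \<i> * dual_covector e 6 X"
  "2 * lambda2_covector e (wedge (vbasis 2) (vbasis 3)) X = dual_covector e 1 X - \<i> * dual_covector e 4 X"
  "2 * lambda2_covector e (wedge (vbasis 3) (vbasis 1)) X = dual_covector e 2 X - \<i> * dual_covector e 5 X"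
  "2 * lambda2_covector e (wedge (vbasis 1) (vbasis 2)) X = dual_covector e 3 X - \<i> * dual_covector e 6 X"
  by (simp_all add: lambda2_covector_def wedge_def vbasis_def axis_def)

end

theory Submission
  imports Defs
begin

text \<open>
  Identify the Lie algebra with complex 3-space through the coordinates \<open>X\<^sub>k + \<i> X\<^sub>k\<^sub>+\<^sub>3\<close>, so that \<open>I\<^sub>0\<close>
  is multiplication by \<open>\<i>\<close>.  For \<open>w = (a, b, c)\<close> let \<open>A\<close> be the cross product \<open>z \<mapsto> w \<times> cnj z\<close>;
  it is skew, anticommutes with \<open>I\<^sub>0\<close> and satisfies \<open>A^3 = - (x - 1) A\<close>.  The covectors
  \<open>\<zeta>\<^sub>k \<circ> (1 - A)\<close>, with \<open>\<zeta>\<^sub>k\<close> the complex coordinates, span \<open>V\<^sub>u\<close> for \<open>u = (1, a, b, c)\<close>, hence the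
  structure belonging to \<open>[1, a, b, c]\<close> is \<open>(1 - A)\<inverse> I\<^sub>0 (1 - A) = I\<^sub>0 (1 - 2 A / x + 2 A\<^sup>2 / x)\<close>.
  Conversely, for \<open>I\<close> in \<open>U(I\<^sub>0)\<close> the map \<open>1 - 2 (1 - I I\<^sub>0)\<inverse>\<close> is skew and anticommutes with
  \<open>I\<^sub>0\<close>, and any such map is a cross product with some \<open>(a, b, c)\<close>.
\<close>

section \<open>Quadratic polynomials in an operator with A^3 = - n A\<close>

definition quad_op :: "('a::real_vector \<Rightarrow> 'a) \<Rightarrow> real \<Rightarrow> real \<Rightarrow> 'a \<Rightarrow> 'a" where
  "quad_op A p q X = X + p *\<^sub>R A X + q *\<^sub>R A (A X)"

lemma linear_quad_op: "linear A \<Longrightarrow> linear (quad_op A p q)"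
  by (rule linearI) (simp_all add: quad_op_def linear_add linear_cmul algebra_simps)

text \<open>Multiplication of 1 + p t + q t^2 modulo t^3 + n t. The operators built from A below (1
  - A, its inverse, the rotation) have constant term 1, so two coefficients encode them.\<close>

lemma quad_op_comp:
  assumes "linear A" and cube: "\<And>X. A (A (A X)) = - (n *\<^sub>R A X)"
  shows "quad_op A p q (quad_op A p' q' X) =
    quad_op A (p + p' - n * (p * q' + q * p')) (q + q' + p * p' - n * q * q') X"
  using assms(1)
  by (simp add: quad_op_def linear_add linear_cmul linear_neg linear_diff cube algebra_simps)

lemma quad_op_adjoint:
  assumes "\<And>X Y. A X \<bullet> Y = - (X \<bullet> A Y)"
  shows "quad_op A p q X \<bullet> Y = X \<bullet> quad_op A (- p) q Y"
  by (simp add: quad_op_def inner_add_left inner_add_right inner_diff_right assms)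

lemma quad_op_id: "quad_op A 0 0 X = X"
  by (simp add: quad_op_def)

section \<open>Enumeration of the index types\<close>

lemma UNIV_6: "(UNIV :: 6 set) = {1, 2, 3, 4, 5, 6}"
proof -
  have "card {1, 2, 3, 4, 5, 6 :: 6} = CARD(6)" by simp
  then show ?thesis
    by (metis card_subset_eq finite_UNIV finite subset_UNIV)
qed

lemma sum_6: "sum f (UNIV :: 6 set) = f 1 + f 2 + f 3 + f 4 + f 5 + f 6"
  unfolding UNIV_6 by (simp add: add.assoc)

lemma all_6: "(\<forall>i::6. P i) \<longleftrightarrow> P 1 \<and> P 2 \<and> P 3 \<and> P 4 \<and> P 5 \<and> P 6"
  using UNIV_6 by (metis UNIV_I empty_iff insert_iff)

lemma UNIV_4_from_0: "(UNIV :: 4 set) = {0, 1, 2, 3}"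
proof -
  have "card {0, 1, 2, 3 :: 4} = CARD(4)" by simp
  then show ?thesis
    by (metis card_subset_eq finite_UNIV finite subset_UNIV)
qed

lemma all_4: "(\<forall>i::4. P i) \<longleftrightarrow> P 0 \<and> P 1 \<and> P 2 \<and> P 3"
  using UNIV_4_from_0 by (metis UNIV_I empty_iff insert_iff)

section \<open>Complex coordinates and the candidate structures\<close>

definition frame_matrix :: "(6 \<Rightarrow> 'a::euclidean_space) \<Rightarrow> ('a \<Rightarrow> 'a) \<Rightarrow> real^6^6" where
  "frame_matrix e S = (\<chi> i j. S (e j) \<bullet> e i)"

text \<open>Meant for \<open>k\<close> = 1, 2, 3. Addition in the index type is modulo 6, and 3 + 3
  is the index \<open>6\<close>, equal to 0.\<close>

definition cxcoord :: "(6 \<Rightarrow> 'a::euclidean_space) \<Rightarrow> 6 \<Rightarrow> 'a \<Rightarrow> complex" where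
  "cxcoord e k X = Complex (X \<bullet> e k) (X \<bullet> e (k + 3))"

definition cxvec :: "(6 \<Rightarrow> 'a::euclidean_space) \<Rightarrow> complex \<Rightarrow> complex \<Rightarrow> complex \<Rightarrow> 'a" where
  "cxvec e p q r = Re p *\<^sub>R e 1 + Re q *\<^sub>R e 2 + Re r *\<^sub>R e 3
     + Im p *\<^sub>R e 4 + Im q *\<^sub>R e 5 + Im r *\<^sub>R e 6"

definition cross_op ::
    "(6 \<Rightarrow> 'a::euclidean_space) \<Rightarrow> complex \<Rightarrow> complex \<Rightarrow> complex \<Rightarrow> 'a \<Rightarrow> 'a" where
  "cross_op e a b c X = cxvec e
     (b * cnj (cxcoord e 3 X) - c * cnj (cxcoord e 2 X))
     (c * cnj (cxcoord e 1 X) - a * cnj (cxcoord e 3 X))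
     (a * cnj (cxcoord e 2 X) - b * cnj (cxcoord e 1 X))"

definition acs_abc ::
    "(6 \<Rightarrow> 'a::euclidean_space) \<Rightarrow> complex \<Rightarrow> complex \<Rightarrow> complex \<Rightarrow> 'a \<Rightarrow> 'a" where
  "acs_abc e a b c X =
     (let x = 1 + (cmod a)\<^sup>2 + (cmod b)\<^sup>2 + (cmod c)\<^sup>2
      in std_acs e (quad_op (cross_op e a b c) (- 2 / x) (2 / x) X))"

definition affine_point :: "complex \<Rightarrow> complex \<Rightarrow> complex \<Rightarrow> complex^4" where
  "affine_point a b c = 1 *s vbasis 0 + a *s vbasis 1 + b *s vbasis 2 + c *s vbasis 3"

lemma affine_point_nth [simp]: "affine_point a b c $ 0 = 1" "affine_point a b c $ 1 = a"
    "affine_point a b c $ 2 = b" "affine_point a b c $ 3 = c"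
  by (simp_all add: affine_point_def vbasis_def axis_def)

lemma affine_point_nonzero: "affine_point a b c \<noteq> 0"
  by (metis affine_point_nth(1) zero_index zero_neq_one)

lemma hpoint_affine: "hpoint 1 a b c = proj_class (affine_point a b c)"
  by (simp add: hpoint_def affine_point_def)

lemma scale_factor_pos:
  assumes "x = 1 + (cmod a)\<^sup>2 + (cmod b)\<^sup>2 + (cmod c)\<^sup>2"
  shows "x > 0"
  by (simp add: assms add_pos_nonneg)

lemma acs_abc_eq:
  assumes "x = 1 + (cmod a)\<^sup>2 + (cmod b)\<^sup>2 + (cmod c)\<^sup>2"
  shows "acs_abc e a b c X = std_acs e (quad_op (cross_op e a b c) (- 2 / x) (2 / x) X)"
  by (simp only: acs_abc_def Let_def assms)

lemma cxcoord_linear_simps: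
  "cxcoord e k (X + Y) = cxcoord e k X + cxcoord e k Y"
  "cxcoord e k (X - Y) = cxcoord e k X - cxcoord e k Y"
  "cxcoord e k (- X) = - cxcoord e k X"
  "cxcoord e k (r *\<^sub>R X) = of_real r * cxcoord e k X"
  by (simp_all add: cxcoord_def complex_eq_iff inner_add_left inner_diff_left)

lemma linear_cross_op: "linear (cross_op e a b c)"
  by (rule linearI)
    (simp_all add: cross_op_def cxvec_def cxcoord_linear_simps algebra_simps)

context
  fixes e :: "6 \<Rightarrow> 'a::euclidean_space"
  assumes frame: "orthonormal_frame e"
begin

section \<open>Coordinates in an orthonormal frame\<close>

lemma frame_inner: "e i \<bullet> e j = (if i = j then 1 else 0)"
  using frame by (simp add: orthonormal_frame_def)

lemma frame_expansion: "X = (\<Sum>i\<in>UNIV. (X \<bullet> e i) *\<^sub>R e i)"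
proof -
  let ?D = "X - (\<Sum>i\<in>UNIV. (X \<bullet> e i) *\<^sub>R e i)"
  have "?D \<bullet> e j = 0" for j
    by (simp add: inner_diff_left inner_sum_left frame_inner if_distrib cong: if_cong)
  then have "orthogonal ?D Y" for Y
    using orthogonal_to_span[of Y "range e" ?D] frame
    by (auto simp: orthonormal_frame_def orthogonal_def)
  then have "?D = 0"
    using orthogonal_self by blast
  then show ?thesis by simp
qed

lemma frame_parseval: "X \<bullet> Y = (\<Sum>i\<in>UNIV. (X \<bullet> e i) * (Y \<bullet> e i))"
  by (subst frame_expansion[of X]) (simp only: inner_sum_left inner_scaleR_left inner_commute[of Y])

lemma frame_eqI: "(\<And>i. X \<bullet> e i = Y \<bullet> e i) \<Longrightarrow> X = Y"
  by (subst frame_expansion[of X], subst frame_expansion[of Y]) simp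

lemma cxcoord_cxvec:
  "cxcoord e 1 (cxvec e p q r) = p" "cxcoord e 2 (cxvec e p q r) = q"
  "cxcoord e 3 (cxvec e p q r) = r"
  by (simp_all add: cxcoord_def cxvec_def inner_add_left frame_inner complex_eq_iff)

lemma cxcoord_eqI:
  assumes "cxcoord e 1 X = cxcoord e 1 Y" "cxcoord e 2 X = cxcoord e 2 Y"
    "cxcoord e 3 X = cxcoord e 3 Y"
  shows "X = Y"
proof -
  have "\<forall>i. X \<bullet> e i = Y \<bullet> e i"
    using assms by (simp add: all_6 cxcoord_def)
  then show ?thesis by (blast intro: frame_eqI)
qed

lemma cxcoord_std_acs:
  "cxcoord e 1 (std_acs e X) = \<i> * cxcoord e 1 X"
  "cxcoord e 2 (std_acs e X) = \<i> * cxcoord e 2 X"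
  "cxcoord e 3 (std_acs e X) = \<i> * cxcoord e 3 X"
  by (simp_all add: cxcoord_def std_acs_def inner_add_left inner_diff_left frame_inner
      complex_eq_iff)

lemma inner_cxcoord:
  "X \<bullet> Y = Re (cxcoord e 1 X * cnj (cxcoord e 1 Y) + cxcoord e 2 X * cnj (cxcoord e 2 Y)
    + cxcoord e 3 X * cnj (cxcoord e 3 Y))"
  by (subst frame_parseval) (simp add: sum_6 cxcoord_def)

section \<open>Algebra of the conjugate cross product\<close>

lemma cxcoord_cross_op:
  "cxcoord e 1 (cross_op e a b c X) = b * cnj (cxcoord e 3 X) - c * cnj (cxcoord e 2 X)"
  "cxcoord e 2 (cross_op e a b c X) = c * cnj (cxcoord e 1 X) - a * cnj (cxcoord e 3 X)"
  "cxcoord e 3 (cross_op e a b c X) = a * cnj (cxcoord e 2 X) - b * cnj (cxcoord e 1 X)"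
  by (simp_all add: cross_op_def cxcoord_cxvec)

text \<open>The left side is the real part of det(w, cnj X, cnj Y) with w = (a, b, c), which changes
  sign when X and Y are exchanged.\<close>

lemma cross_op_skew: "cross_op e a b c X \<bullet> Y = - (X \<bullet> cross_op e a b c Y)"
  by (simp add: inner_cxcoord cxcoord_cross_op algebra_simps)

text \<open>The conjugate in the cross product turns the factor \<i> into -\<i>.\<close>

lemma cross_op_anticomm: "cross_op e a b c (std_acs e X) = - std_acs e (cross_op e a b c X)"
  by (rule cxcoord_eqI)
    (simp_all add: cxcoord_cross_op cxcoord_std_acs cxcoord_linear_simps algebra_simps)

text \<open>With w = (a, b, c) and the complex bilinear dot product, the triple product identity
  gives A^2 z = (w . z) cnj w - |w|^2 z. At A z the first term vanishes, since w . (w x cnj z) =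
  0.\<close>

lemma cross_op_cube:
  "cross_op e a b c (cross_op e a b c (cross_op e a b c X)) =
    - (((cmod a)\<^sup>2 + (cmod b)\<^sup>2 + (cmod c)\<^sup>2) *\<^sub>R cross_op e a b c X)"
  by (rule cxcoord_eqI)
    (simp_all add: cxcoord_cross_op cxcoord_linear_simps complex_norm_square algebra_simps
      del: of_real_power)

lemma std_acs_orthogonal: "std_acs e X \<bullet> std_acs e Y = X \<bullet> Y"
  by (simp add: inner_cxcoord cxcoord_std_acs)

lemma std_acs_quad_op:
  "quad_op (cross_op e a b c) p q (std_acs e X) = std_acs e (quad_op (cross_op e a b c) (- p) q X)"
  by (simp add: quad_op_def cross_op_anticomm linear_add[OF linear_std_acs]
      linear_cmul[OF linear_std_acs] linear_diff[OF linear_std_acs] linear_neg[OF linear_std_acs]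
      linear_neg[OF linear_cross_op])

section \<open>Determinants and orientation\<close>

lemma frame_matrix_comp:
  assumes "linear S"
  shows "frame_matrix e (S \<circ> T) = frame_matrix e S ** frame_matrix e T"
proof -
  have "S (T (e j)) \<bullet> e i = (\<Sum>k\<in>UNIV. (S (e k) \<bullet> e i) * (T (e j) \<bullet> e k))" for i j
    by (subst frame_expansion[of "T (e j)"])
      (simp add: linear_sum[OF assms] linear_cmul[OF assms] inner_sum_left mult.commute)
  then show ?thesis
    by (simp add: frame_matrix_def matrix_matrix_mult_def vec_eq_iff)
qed

text \<open>A complex structure is the square of \<open>(1 + K) / sqrt 2\<close>.\<close>

lemma det_complex_structure_nonneg:
  assumes "linear K" "\<And>X. K (K X) = - X"
  shows "det (frame_matrix e K) \<ge> 0"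
proof -
  define R where "R X = (1 / sqrt 2) *\<^sub>R (X + K X)" for X
  have lin: "linear R"
    using assms(1) by (intro linearI) (simp_all add: R_def linear_add linear_cmul algebra_simps)
  have "(1 / sqrt 2) *\<^sub>R (1 / sqrt 2) *\<^sub>R (K X + K X) = K X" for X
    by (simp flip: scaleR_2)
  then have "R \<circ> R = K"
    using assms by (simp add: R_def fun_eq_iff linear_add linear_cmul algebra_simps)
  then have "det (frame_matrix e K) = (det (frame_matrix e R))\<^sup>2"
    using frame_matrix_comp[OF lin, of R] by (simp add: det_mul power2_eq_square)
  then show ?thesis by simp
qed

lemma det_frame_orthogonal:
  assumes "orthogonal_transformation S"
  shows "(det (frame_matrix e S))\<^sup>2 = 1"
proof -
  have "transpose (frame_matrix e S) ** frame_matrix e S = mat 1"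
    using assms
    by (simp add: frame_matrix_def matrix_matrix_mult_def transpose_def mat_def vec_eq_iff
        orthogonal_transformation_def frame_inner flip: frame_parseval)
  then have "det (transpose (frame_matrix e S)) * det (frame_matrix e S) = 1"
    by (metis det_I det_mul)
  then show ?thesis by (simp add: det_transpose power2_eq_square)
qed

text \<open>Both \<open>S I\<^sub>0\<close> and \<open>I\<^sub>0\<close> are complex structures, so \<open>det S\<close> is positive.\<close>

lemma SO_frameI:
  assumes "orthogonal_transformation S" and
    "\<And>X. S (std_acs e (S (std_acs e X))) = - X"
  shows "S \<in> SO_frame e"
proof -
  have lin: "linear S" using assms(1) by (simp add: orthogonal_transformation_def)
  have "det (frame_matrix e (S \<circ> std_acs e)) \<ge> 0"
    by (rule det_complex_structure_nonneg)
      (use assms(2) lin linear_std_acs in \<open>auto intro: linear_compose\<close>)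
  moreover have "det (frame_matrix e (std_acs e)) \<ge> 0"
    by (rule det_complex_structure_nonneg) (simp_all add: linear_std_acs std_acs_square[OF frame])
  moreover have "(det (frame_matrix e S))\<^sup>2 = 1" "(det (frame_matrix e (std_acs e)))\<^sup>2 = 1"
    by (auto intro!: det_frame_orthogonal assms(1)
        simp: orthogonal_transformation_def linear_std_acs std_acs_orthogonal)
  ultimately have "det (frame_matrix e S) = 1"
    by (auto simp: frame_matrix_comp[OF lin] det_mul power2_eq_1_iff)
  then show ?thesis
    using assms(1) by (simp add: SO_frame_def frame_matrix_def)
qed

section \<open>Membership of \<open>acs_abc\<close> in the space of structures and in U(I_0)\<close>

lemma cross_quad_op_comp:
  assumes "x = 1 + (cmod a)\<^sup>2 + (cmod b)\<^sup>2 + (cmod c)\<^sup>2"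
  shows "quad_op (cross_op e a b c) p q (quad_op (cross_op e a b c) p' q' X) =
    quad_op (cross_op e a b c) (p + p' - (x - 1) * (p * q' + q * p'))
      (q + q' + p * p' - (x - 1) * q * q') X"
  by (rule quad_op_comp) (simp_all add: linear_cross_op cross_op_cube assms)

lemma acs_spaceD:
  assumes "I \<in> acs_space e"
  shows "linear I" "I X \<bullet> I Y = X \<bullet> Y" "I (I X) = - X"
proof -
  from assms obtain S where S: "S \<in> SO_frame e" "I = S \<circ> std_acs e \<circ> inv S"
    by (auto simp: acs_space_def)
  then have ortho: "orthogonal_transformation S" by (simp add: SO_frame_def)
  then have bij: "bij S" and inv: "orthogonal_transformation (inv S)"
    by (simp_all add: orthogonal_transformation_bij orthogonal_transformation_inv)
  have std: "orthogonal_transformation (std_acs e)"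
    by (simp add: orthogonal_transformation_def linear_std_acs std_acs_orthogonal)
  have "orthogonal_transformation I"
    unfolding S(2) by (intro orthogonal_transformation_compose ortho inv std)
  then show "linear I" "I X \<bullet> I Y = X \<bullet> Y"
    by (simp_all add: orthogonal_transformation_def)
  have "linear S" using ortho by (simp add: orthogonal_transformation_def)
  then show "I (I X) = - X"
    using bij by (simp add: S(2) bij_is_inj bij_is_surj surj_f_inv_f std_acs_square[OF frame] linear_neg)
qed

text \<open>The rotation is the orthogonal part in the polar decomposition of \<open>1 + A\<close>, where
  \<open>A = cross_op e a b c\<close>; its square is the Cayley transform \<open>(1 + A) (1 - A)\<inverse>\<close>.\<close>

lemma acs_abc_in_acs_space: "acs_abc e a b c \<in> acs_space e"
proof -
  define x where "x = 1 + (cmod a)\<^sup>2 + (cmod b)\<^sup>2 + (cmod c)\<^sup>2"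
  define s where "s = sqrt x"
  \<comment> \<open>On the image of A, where A^2 = - (x - 1), the orthogonal part of 1 + A is (1 +
    A) / s; on the kernel it is 1. The polynomial 1 + A / s + q A^2 is both when 1 - q (s^2 - 1) = 1
    / s. This form of q also covers s = 1.\<close>
  define q where "q = 1 / (s * (s + 1))"
  have "x > 0" by (rule scale_factor_pos[OF x_def])
  then have s: "s > 0" "x = s\<^sup>2" by (simp_all add: s_def)
  define S where "S = quad_op (cross_op e a b c) (1 / s) q"
  define S' where "S' = quad_op (cross_op e a b c) (- 1 / s) q"
  note comp = cross_quad_op_comp[OF x_def]
  have ne: "s \<noteq> 0" "s + 1 \<noteq> 0" using s by simp_all
  have q1: "(s\<^sup>2 - 1) * q = (s - 1) / s"
    using ne by (simp add: q_def power2_eq_square square_diff_one_factored)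
  \<comment> \<open>\<open>q2\<close> is the vanishing A^2 coefficient of
    \<open>S' \<circ> S\<close>; \<open>q3\<close> and \<open>q4\<close> are the A^2 and A
    coefficients of \<open>S' \<circ> S'\<close>, matching those in \<open>acs_abc\<close>.\<close>
  have q2: "q + q - 1 / s * (1 / s) - (s\<^sup>2 - 1) * q * q = 0"
    unfolding q1 q_def using ne
    by (simp add: divide_simps) (simp add: algebra_simps power2_eq_square)
  have q3: "q + q + - 1 / s * (- 1 / s) - (s\<^sup>2 - 1) * q * q = 2 / s\<^sup>2"
    unfolding q1 q_def power2_eq_square using ne
    by (simp add: divide_simps) (simp add: algebra_simps)
  have q4: "- 1 / s + - 1 / s - (s\<^sup>2 - 1) * (- 1 / s * q + q * (- 1 / s)) = - 2 / s\<^sup>2"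
  proof -
    have "- 1 / s + - 1 / s - (s\<^sup>2 - 1) * (- 1 / s * q + q * (- 1 / s)) =
        2 / s * ((s\<^sup>2 - 1) * q) - 2 / s"
      by (simp add: algebra_simps add_divide_distrib diff_divide_distrib)
    also have "\<dots> = - 2 / s\<^sup>2"
      unfolding q1 using ne by (simp add: divide_simps power2_eq_square)
    finally show ?thesis .
  qed
  have inv: "S' (S X) = X" "S (S' X) = X" for X
    using q2 by (simp_all add: S_def S'_def comp s quad_op_id algebra_simps)
  then have "inv S = S'" by (metis inv_equality)
  have linS: "linear S" by (simp add: S_def linear_quad_op linear_cross_op)
  have "S X \<bullet> S Y = X \<bullet> Y" for X Y
  proof -
    have "S X \<bullet> S Y = X \<bullet> S' (S Y)"
      by (simp add: S_def S'_def quad_op_adjoint[OF cross_op_skew])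
    then show ?thesis by (simp add: inv)
  qed
  with linS have "orthogonal_transformation S"
    by (simp add: orthogonal_transformation_def)
  \<comment> \<open>With J = \<open>std_acs e\<close>, the relation \<open>S J = J S'\<close> yields
    \<open>S J S J = J J = - 1\<close>, the hypothesis of \<open>SO_frameI\<close>, and
    \<open>S J S' = J S' S'\<close>.\<close>
  moreover have anti: "S (std_acs e X) = std_acs e (S' X)" for X
    by (simp add: S_def S'_def std_acs_quad_op)
  ultimately have "S \<in> SO_frame e"
    by (intro SO_frameI) (simp_all add: std_acs_square[OF frame] inv linear_neg[OF linS])
  moreover have "acs_abc e a b c = S \<circ> std_acs e \<circ> S'"
  proof
    fix X
    have "S' (S' X) = quad_op (cross_op e a b c) (- 2 / x) (2 / x) X"
      unfolding S'_def comp s(2) q3 q4 ..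
    then show "acs_abc e a b c X = (S \<circ> std_acs e \<circ> S') X"
      by (simp add: anti acs_abc_eq[OF x_def])
  qed
  ultimately show ?thesis
    unfolding acs_space_def using \<open>inv S = S'\<close> by blast
qed

text \<open>The next two lemmas say that \<open>acs_abc = (1 - A)\<inverse> I\<^sub>0 (1 - A)\<close> and
  \<open>1 - acs_abc I\<^sub>0 = 2 (1 - A)\<inverse>\<close>.\<close>

lemma acs_abc_cayley:
  "quad_op (cross_op e a b c) (- 1) 0 (acs_abc e a b c X) =
    std_acs e (quad_op (cross_op e a b c) (- 1) 0 X)"
proof -
  define x where "x = 1 + (cmod a)\<^sup>2 + (cmod b)\<^sup>2 + (cmod c)\<^sup>2"
  have "x > 0" by (rule scale_factor_pos[OF x_def])
  then show ?thesis
    unfolding acs_abc_eq[OF x_def] std_acs_quad_op cross_quad_op_comp[OF x_def]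
    by (simp add: field_simps)
qed

lemma acs_abc_std_acs:
  assumes x: "x = 1 + (cmod a)\<^sup>2 + (cmod b)\<^sup>2 + (cmod c)\<^sup>2"
  shows "X - acs_abc e a b c (std_acs e X) = 2 *\<^sub>R quad_op (cross_op e a b c) (1 / x) (1 / x) X"
  unfolding acs_abc_eq[OF x] std_acs_quad_op
  by (simp add: std_acs_square[OF frame] quad_op_def scaleR_add_right scaleR_2)

text \<open>(1 - A) (1 + A / x + A^2 / x) = 1 + (1 / x - 1) A - A^3 / x, and the last two terms
  cancel because A^3 = - (x - 1) A.\<close>

lemma cross_quad_op_inverse:
  assumes x: "x = 1 + (cmod a)\<^sup>2 + (cmod b)\<^sup>2 + (cmod c)\<^sup>2"
  shows "quad_op (cross_op e a b c) (- 1) 0 (quad_op (cross_op e a b c) (1 / x) (1 / x) X) = X"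
    "quad_op (cross_op e a b c) (1 / x) (1 / x) (quad_op (cross_op e a b c) (- 1) 0 X) = X"
proof -
  have "x > 0" by (rule scale_factor_pos[OF x])
  then show "quad_op (cross_op e a b c) (- 1) 0 (quad_op (cross_op e a b c) (1 / x) (1 / x) X) = X"
    "quad_op (cross_op e a b c) (1 / x) (1 / x) (quad_op (cross_op e a b c) (- 1) 0 X) = X"
    unfolding cross_quad_op_comp[OF x]
    by (simp_all add: field_simps quad_op_id)
qed

lemma acs_abc_in_acs_nbhd: "acs_abc e a b c \<in> acs_nbhd e"
proof -
  define x where "x = 1 + (cmod a)\<^sup>2 + (cmod b)\<^sup>2 + (cmod c)\<^sup>2"
  note inv = cross_quad_op_inverse[OF x_def]
  have "bij (\<lambda>X. 2 *\<^sub>R quad_op (cross_op e a b c) (1 / x) (1 / x) X)"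
    by (rule o_bij[where g = "\<lambda>X. quad_op (cross_op e a b c) (- 1) 0 ((1/2) *\<^sub>R X)"])
      (simp_all add: fun_eq_iff inv linear_cmul[OF linear_quad_op[OF linear_cross_op]])
  then show ?thesis
    by (simp add: acs_nbhd_def acs_abc_in_acs_space acs_abc_std_acs[OF x_def])
qed

section \<open>The (1,0)-covectors of \<open>acs_abc\<close>\<close>

lemma covectors10_std_acs_expansion:
  assumes "\<alpha> \<in> covectors10 (std_acs e)"
  shows "\<alpha> X = \<alpha> (e 1) * cxcoord e 1 X + \<alpha> (e 2) * cxcoord e 2 X + \<alpha> (e 3) * cxcoord e 3 X"
proof -
  have lin: "linear \<alpha>" and I: "\<And>X. \<alpha> (std_acs e X) = \<i> * \<alpha> X"
    using assms by (auto simp: covectors10_def)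
  have e: "\<alpha> (e 4) = \<i> * \<alpha> (e 1)" "\<alpha> (e 5) = \<i> * \<alpha> (e 2)" "\<alpha> (e 6) = \<i> * \<alpha> (e 3)"
    using I[of "e 1"] I[of "e 2"] I[of "e 3"] by (simp_all add: std_acs_frame[OF frame])
  have "\<alpha> X = (\<Sum>i\<in>UNIV. of_real (X \<bullet> e i) * \<alpha> (e i))"
    by (subst frame_expansion[of X])
      (simp add: linear_sum[OF lin] linear_cmul[OF lin] scaleR_conv_of_real)
  then show ?thesis
    by (simp add: sum_6 e cxcoord_def Complex_eq algebra_simps)
qed

text \<open>Since u \<and> v = u \<and> (v - v_0 u), only vectors with zero component 0 count. For
  these the entries of the wedge at (2,3), (3,1), (1,2) are the components of (a, b, c) x v, so 2 u
  \<and> \<open>vbasis k\<close> becomes \<open>cxcoord e k\<close> composed with 1 - A.\<close>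

lemma Vspace_eq:
  "Vspace e (affine_point a b c) =
    {(\<lambda>X. let Y = quad_op (cross_op e a b c) (- 1) 0 X in
        p * cxcoord e 1 Y + q * cxcoord e 2 Y + r * cxcoord e 3 Y) | p q r. True}"
  (is "Vspace e ?u = {?f p q r | p q r. True}")
proof -
  have *: "lambda2_covector e (wedge ?u v) =
    ?f ((v $ 1 - a * v $ 0) / 2) ((v $ 2 - b * v $ 0) / 2) ((v $ 3 - c * v $ 0) / 2)" for v
    by (simp add: lambda2_covector_def wedge_def dual_covector_def Let_def
        quad_op_def cxcoord_linear_simps cxcoord_cross_op fun_eq_iff)
      (simp add: cxcoord_def Complex_eq complex_cnj field_simps)
  show ?thesis
  proof (intro equalityI subsetI)
    fix \<alpha> assume "\<alpha> \<in> Vspace e ?u"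
    then show "\<alpha> \<in> {?f p q r | p q r. True}"
      unfolding Vspace_def using * by blast
  next
    fix \<alpha> assume "\<alpha> \<in> {?f p q r | p q r. True}"
    then obtain p q r where \<alpha>: "\<alpha> = ?f p q r" by blast
    define v where "v = (2 * p) *s vbasis 1 + (2 * q) *s vbasis 2 + (2 * r) *s vbasis 3"
    have "v $ 0 = 0" "v $ 1 = 2 * p" "v $ 2 = 2 * q" "v $ 3 = 2 * r"
      by (simp_all add: v_def vbasis_def axis_def)
    then have "\<alpha> = lambda2_covector e (wedge ?u v)"
      unfolding * \<alpha> by simp
    then show "\<alpha> \<in> Vspace e ?u"
      unfolding Vspace_def by blast
  qed
qed

text \<open>\<open>F\<close> intertwines \<open>acs_abc e a b c\<close> with
  \<open>std_acs e\<close>, so composition with \<open>F\<close> carries the (1,0)-covectors of the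
  latter onto those of the former; \<open>Vspace_eq\<close> describes exactly these
  composites.\<close>

lemma covectors10_acs_abc:
  "covectors10 (acs_abc e a b c) =
    Vspace e (affine_point a b c)"
proof -
  define x where "x = 1 + (cmod a)\<^sup>2 + (cmod b)\<^sup>2 + (cmod c)\<^sup>2"
  define F where "F = quad_op (cross_op e a b c) (- 1) 0"
  define G where "G = quad_op (cross_op e a b c) (1 / x) (1 / x)"
  have lin: "linear F" "linear G"
    by (simp_all add: F_def G_def linear_quad_op linear_cross_op)
  have FG: "F (G X) = X" "G (F X) = X" for X
    using cross_quad_op_inverse[OF x_def] by (simp_all add: F_def G_def)
  have FJ: "F (acs_abc e a b c X) = std_acs e (F X)" for X
    by (simp add: F_def acs_abc_cayley)
  have JG: "acs_abc e a b c (G X) = G (std_acs e X)" for X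
    by (metis FG FJ)
  show ?thesis
  proof (intro equalityI subsetI)
    fix \<alpha> assume "\<alpha> \<in> covectors10 (acs_abc e a b c)"
    then have "linear \<alpha>" and \<alpha>: "\<And>X. \<alpha> (acs_abc e a b c X) = \<i> * \<alpha> X"
      by (auto simp: covectors10_def)
    have "\<alpha> \<circ> G \<in> covectors10 (std_acs e)"
      using linear_compose[OF lin(2) \<open>linear \<alpha>\<close>] \<alpha> by (simp add: covectors10_def flip: JG)
    from covectors10_std_acs_expansion[OF this]
    have "\<alpha> X = \<alpha> (G (e 1)) * cxcoord e 1 (F X) + \<alpha> (G (e 2)) * cxcoord e 2 (F X)
        + \<alpha> (G (e 3)) * cxcoord e 3 (F X)" for X
      using FG(2)[of X] by (metis comp_apply)
    then show "\<alpha> \<in> Vspace e (affine_point a b c)"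
      unfolding Vspace_eq F_def Let_def by blast
  next
    fix \<alpha> assume "\<alpha> \<in> Vspace e (affine_point a b c)"
    then obtain p q r where \<alpha>: "\<alpha> = (\<lambda>X. p * cxcoord e 1 (F X) + q * cxcoord e 2 (F X)
        + r * cxcoord e 3 (F X))"
      unfolding Vspace_eq F_def Let_def by blast
    have "linear \<alpha>"
      unfolding \<alpha> by (rule linearI)
        (simp_all add: linear_add[OF lin(1)] linear_cmul[OF lin(1)] cxcoord_linear_simps
          scaleR_conv_of_real algebra_simps)
    moreover have "\<alpha> (acs_abc e a b c X) = \<i> * \<alpha> X" for X
      by (simp add: \<alpha> FJ cxcoord_std_acs algebra_simps)
    ultimately show "\<alpha> \<in> covectors10 (acs_abc e a b c)"
      by (simp add: covectors10_def)
  qed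
qed

text \<open>The real parts of the (1,0)-covectors \<open>\<beta> - \<i> \<beta> \<circ> I\<close> are arbitrary.\<close>

lemma covectors10_determines_acs:
  assumes I: "linear I" "\<And>X. I (I X) = - X" and eq: "covectors10 I = covectors10 J"
  shows "I = J"
proof
  fix X
  have "I X \<bullet> Y = J X \<bullet> Y" for Y
  proof -
    define \<alpha> where "\<alpha> X = Complex (X \<bullet> Y) (- (I X \<bullet> Y))" for X
    have "linear \<alpha>"
      using I(1) by (intro linearI)
        (simp_all add: \<alpha>_def complex_eq_iff linear_add linear_cmul inner_add_left)
    moreover have "\<alpha> (I X) = \<i> * \<alpha> X" for X
      by (simp add: \<alpha>_def I(2) complex_eq_iff)
    ultimately have "\<alpha> \<in> covectors10 I"
      by (simp add: covectors10_def)
    then have "\<alpha> \<in> covectors10 J" by (simp only: eq)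
    then have "Re (\<alpha> (J X)) = Re (\<i> * \<alpha> X)"
      by (simp add: covectors10_def)
    then show ?thesis by (simp add: \<alpha>_def)
  qed
  then show "I X = J X" using vector_eq_rdot by blast
qed

section \<open>Every structure in U(I_0) is some \<open>acs_abc\<close>\<close>

text \<open>In complex coordinates an antilinear map is z -> B cnj z. Skewness, tested on frame
  vectors and on their images under \<open>std_acs e\<close>, makes the complex 3 x 3 matrix B
  skew-symmetric, hence a cross product.\<close>

lemma skew_antilinear_eq_cross_op:
  assumes lin: "linear A" and skew: "\<And>X Y. A X \<bullet> Y = - (X \<bullet> A Y)"
    and anti: "\<And>X. A (std_acs e X) = - std_acs e (A X)"
  shows "\<exists>a b c. A = cross_op e a b c"
proof -
  define B where "B j k = cxcoord e j (A (e k))" for j k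
  have e: "e 4 = std_acs e (e 1)" "e 5 = std_acs e (e 2)" "e 6 = std_acs e (e 3)"
    by (simp_all add: std_acs_frame[OF frame])
  have expand: "A X = (\<Sum>i\<in>UNIV. (X \<bullet> e i) *\<^sub>R A (e i))" for X
    by (subst frame_expansion[of X]) (simp add: linear_sum[OF lin] linear_cmul[OF lin])
  have coord: "cxcoord e j (A X) = B j 1 * cnj (cxcoord e 1 X) + B j 2 * cnj (cxcoord e 2 X)
      + B j 3 * cnj (cxcoord e 3 X)" if "j \<in> {1, 2, 3}" for j X
  proof -
    have "A (e 4) = - std_acs e (A (e 1))" "A (e 5) = - std_acs e (A (e 2))"
      "A (e 6) = - std_acs e (A (e 3))"
      by (simp_all add: e anti)
    then show ?thesis
      using that unfolding expand[of X]
      by (auto simp: sum_6 cxcoord_linear_simps cxcoord_std_acs B_def)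
        (simp_all add: cxcoord_def[of e _ X] Complex_eq algebra_simps)
  qed
  have re: "A (e i) \<bullet> e j = - (A (e j) \<bullet> e i)" for i j
    by (metis inner_commute skew)
  have im: "A (e i) \<bullet> std_acs e (e j) = - (A (e j) \<bullet> std_acs e (e i))" for i j
  proof -
    have "A (e i) \<bullet> std_acs e (e j) = e i \<bullet> std_acs e (A (e j))"
      by (simp add: skew anti)
    also have "\<dots> = std_acs e (e i) \<bullet> std_acs e (std_acs e (A (e j)))"
      by (simp only: std_acs_orthogonal)
    finally show ?thesis
      by (simp add: std_acs_square[OF frame] inner_commute)
  qed
  have B: "B 1 1 = 0" "B 2 2 = 0" "B 3 3 = 0" "B 1 2 = - B 2 1" "B 2 3 = - B 3 2" "B 3 1 = - B 1 3"
    using re[of 1 1] re[of 2 2] re[of 3 3] re[of 1 2] re[of 2 3] re[of 3 1]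
      im[of 1 1] im[of 2 2] im[of 3 3] im[of 1 2] im[of 2 3] im[of 3 1]
    by (simp_all add: B_def cxcoord_def complex_eq_iff std_acs_frame[OF frame])
  \<comment> \<open>The entries (3,2), (1,3), (2,1) of a cross product matrix form its axial
    vector.\<close>
  have "A X = cross_op e (B 3 2) (B 1 3) (B 2 1) X" for X
    by (rule cxcoord_eqI) (simp_all add: coord cxcoord_cross_op B)
  then show ?thesis by blast
qed

lemma acs_nbhd_eq_acs_abc:
  assumes "I \<in> acs_nbhd e"
  shows "\<exists>a b c. I = acs_abc e a b c"
proof -
  define T where "T X = X - I (std_acs e X)" for X
  have "I \<in> acs_space e" and "bij T"
    using assms by (auto simp: acs_nbhd_def T_def[abs_def])
  note I = acs_spaceD[OF this(1)]
  note lin_simps = linear_add linear_cmul linear_diff linear_neg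
  note std_simps = lin_simps[OF linear_std_acs] std_acs_square[OF frame] std_acs_orthogonal
  have linT: "linear T"
    by (rule linearI)
      (simp_all add: T_def std_simps lin_simps[OF I(1)] algebra_simps)
  \<comment> \<open>This solves T = 2 (1 - A)^{-1} for A, the relation that
    \<open>acs_abc_std_acs\<close> dictates.\<close>
  define A where "A X = X - 2 *\<^sub>R inv T X" for X
  have invT: "inv T (T X) = X" "T (inv T X) = X" for X
    using \<open>bij T\<close> by (simp_all add: bij_is_inj bij_is_surj surj_f_inv_f)
  have lin_inv: "linear (inv T)"
    using linT \<open>bij T\<close> by (simp add: bij_is_inj bij_is_surj inj_linear_imp_inv_linear)
  have linA: "linear A"
    by (rule linearI)
      (simp_all add: A_def lin_simps[OF lin_inv] algebra_simps)
  have AT: "A (T X) = T X - 2 *\<^sub>R X" for X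
    by (simp add: A_def invT)
  \<comment> \<open>Both sides are 2 X . Y plus the same mixed terms, since I and
    \<open>std_acs e\<close> are orthogonal. By \<open>AT\<close> this is skewness of A on the range
    of T.\<close>
  have TT: "T X \<bullet> T Y = X \<bullet> T Y + T X \<bullet> Y" for X Y
    by (simp add: T_def inner_diff_left inner_diff_right I(2) std_simps)
  have skew: "A X \<bullet> Y = - (X \<bullet> A Y)" for X Y
  proof -
    obtain X' Y' where "X = T X'" "Y = T Y'" by (metis invT(2))
    then show ?thesis
      using TT[of X' Y'] by (simp add: AT inner_diff_left inner_diff_right)
  qed
  have anti: "A (std_acs e X) = - std_acs e (A X)" for X
  proof -
    obtain Y where X: "X = T Y" by (metis invT(2))
    \<comment> \<open>With J = \<open>std_acs e\<close> this says inv T J + J inv T = J, and inv T =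
      (1 - A) / 2 turns it into A J = - J A.\<close>
    have "T (std_acs e (T Y) - std_acs e Y) = std_acs e (T Y)"
      by (simp add: T_def std_simps lin_simps[OF I(1)] I(3))
    then have "inv T (std_acs e X) = std_acs e X - std_acs e Y"
      by (metis X invT(1))
    moreover have "inv T X = Y" by (simp add: X invT)
    ultimately show ?thesis
      by (simp add: A_def std_simps algebra_simps scaleR_2)
  qed
  obtain a b c where abc: "A = cross_op e a b c"
    using skew_antilinear_eq_cross_op[OF linA skew anti] by blast
  define x where "x = 1 + (cmod a)\<^sup>2 + (cmod b)\<^sup>2 + (cmod c)\<^sup>2"
  have half: "quad_op A (- 1) 0 (T X) = 2 *\<^sub>R X" for X
    by (simp add: quad_op_def AT)
  have "T X = X - acs_abc e a b c (std_acs e X)" for X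
  proof -
    have "T X = quad_op A (1 / x) (1 / x) (quad_op A (- 1) 0 (T X))"
      by (simp add: abc cross_quad_op_inverse[OF x_def])
    also have "\<dots> = 2 *\<^sub>R quad_op A (1 / x) (1 / x) X"
      by (simp only: half linear_cmul[OF linear_quad_op[OF linA]])
    finally show ?thesis by (simp only: acs_abc_std_acs[OF x_def] abc)
  qed
  then have "I (std_acs e X) = acs_abc e a b c (std_acs e X)" for X
    by (simp add: T_def)
  then have "I X = acs_abc e a b c X" for X
    using std_simps(5)[of X] by (metis add.inverse_inverse std_acs_square[OF frame])
  then show ?thesis by blast
qed

section \<open>Recovering the line of u from V_u\<close>

text \<open>The values on the frame are, up to factors, sums and differences of complementary
  coordinates such as (0,1) and (2,3). They give the six entries that
  \<open>lambda2_covector\<close> reads; the other ten follow because wedges are skew.\<close>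

lemma lambda2_covector_inj:
  assumes "lambda2_covector e (wedge u v) = lambda2_covector e (wedge u' v')"
  shows "wedge u v = wedge u' v'"
proof -
  have *: "2 * lambda2_covector e w (e 1) = w $ 0 $ 1 + w $ 2 $ 3"
    "2 * lambda2_covector e w (e 2) = w $ 0 $ 2 + w $ 3 $ 1"
    "2 * lambda2_covector e w (e 3) = w $ 0 $ 3 + w $ 1 $ 2"
    "2 * lambda2_covector e w (e 4) = \<i> * (w $ 0 $ 1 - w $ 2 $ 3)"
    "2 * lambda2_covector e w (e 5) = \<i> * (w $ 0 $ 2 - w $ 3 $ 1)"
    "2 * lambda2_covector e w (e 6) = \<i> * (w $ 0 $ 3 - w $ 1 $ 2)" for w
    by (simp_all add: lambda2_covector_def dual_covector_frame[OF frame] field_simps)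
  let ?w = "wedge u v" and ?w' = "wedge u' v'"
  have eq: "2 * lambda2_covector e ?w (e i) = 2 * lambda2_covector e ?w' (e i)" for i
    using assms by simp
  have sum: "?w $ 0 $ 1 + ?w $ 2 $ 3 = ?w' $ 0 $ 1 + ?w' $ 2 $ 3"
    "?w $ 0 $ 2 + ?w $ 3 $ 1 = ?w' $ 0 $ 2 + ?w' $ 3 $ 1"
    "?w $ 0 $ 3 + ?w $ 1 $ 2 = ?w' $ 0 $ 3 + ?w' $ 1 $ 2"
    using eq[of 1] eq[of 2] eq[of 3] unfolding * by this+
  have diff: "?w $ 0 $ 1 - ?w $ 2 $ 3 = ?w' $ 0 $ 1 - ?w' $ 2 $ 3"
    "?w $ 0 $ 2 - ?w $ 3 $ 1 = ?w' $ 0 $ 2 - ?w' $ 3 $ 1"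
    "?w $ 0 $ 3 - ?w $ 1 $ 2 = ?w' $ 0 $ 3 - ?w' $ 1 $ 2"
    using eq[of 4] eq[of 5] eq[of 6] unfolding * by simp_all
  have half: "p = p' \<and> q = q'" if "p + q = p' + q'" "p - q = p' - q'" for p q p' q' :: complex
    using that by (auto simp: complex_eq_iff)
  have skew: "wedge y z $ i $ j = - wedge y z $ j $ i" for y z i j
    by (simp add: wedge_def)
  have diag: "wedge y z $ i $ i = 0" for y z i
    by (simp add: wedge_def)
  note upper = half[OF sum(1) diff(1)] half[OF sum(2) diff(2)] half[OF sum(3) diff(3)]
  note lower = skew[of _ _ 1 0] skew[of _ _ 2 0] skew[of _ _ 3 0]
    skew[of _ _ 3 2] skew[of _ _ 1 3] skew[of _ _ 2 1]
  have "\<forall>i j. ?w $ i $ j = ?w' $ i $ j"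
    unfolding all_4 by (simp only: lower diag upper)
  then show ?thesis by (simp add: vec_eq_iff)
qed

text \<open>For \<open>k \<noteq> 0, j\<close>, the Pluecker-type relation satisfied by \<open>u' \<and> v\<^sup>k \<in> V\<^sub>u\<close> says that the
  \<open>(0, j)\<close> entry of \<open>u \<and> u'\<close> vanishes.\<close>

lemma Vspace_subset_imp_parallel:
  assumes "Vspace e u' \<subseteq> Vspace e u" "u $ 0 = 1"
  shows "u' = (u' $ 0) *s u"
proof -
  have *: "u' $ j = u' $ 0 * u $ j" if jk: "k \<noteq> 0" "k \<noteq> j" "j \<noteq> 0" for j k
  proof -
    have "lambda2_covector e (wedge u' (vbasis k)) \<in> Vspace e u"
      using assms(1) by (auto simp: Vspace_def)
    then obtain v where v: "wedge u' (vbasis k) = wedge u v"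
      by (auto simp: Vspace_def dest: lambda2_covector_inj)
    have "u' $ j = u $ j * v $ k - v $ j * u $ k" "u' $ 0 = v $ k - v $ 0 * u $ k"
      "0 = v $ j - v $ 0 * u $ j"
      using arg_cong[OF v, of "\<lambda>w. w $ j $ k"] arg_cong[OF v, of "\<lambda>w. w $ 0 $ k"]
        arg_cong[OF v, of "\<lambda>w. w $ 0 $ j"] jk assms(2)
      by (simp_all add: wedge_def vbasis_def axis_def)
    then show ?thesis by algebra
  qed
  have "\<forall>j. u' $ j = u' $ 0 * u $ j"
    using *[of 2 1] *[of 1 2] *[of 1 3] assms(2) by (simp add: all_4)
  then show ?thesis unfolding vec_eq_iff vector_smult_component .
qed

end

section \<open>Homogeneous coordinates and the affine chart of CP3\<close>

lemma proj_class_scale: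
  assumes "k \<noteq> 0"
  shows "proj_class (k *s u) = proj_class u"
proof (intro equalityI subsetI)
  fix w assume "w \<in> proj_class (k *s u)"
  then obtain l where "l \<noteq> 0" "w = (l * k) *s u" by (auto simp: proj_class_def)
  with assms show "w \<in> proj_class u" unfolding proj_class_def by force
next
  fix w assume "w \<in> proj_class u"
  then obtain l where l: "l \<noteq> 0" "w = l *s u" by (auto simp: proj_class_def)
  then have "w = (l / k) *s (k *s u)" "l / k \<noteq> 0" using assms by simp_all
  then show "w \<in> proj_class (k *s u)" unfolding proj_class_def by blast
qed

lemma proj_class_eqD:
  assumes "proj_class u = proj_class u'"
  shows "\<exists>k. k \<noteq> 0 \<and> u = k *s u'"
proof -
  have "u \<in> proj_class u" unfolding proj_class_def by (auto intro!: exI[of _ 1])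
  then have "u \<in> proj_class u'" by (simp only: assms)
  then show ?thesis unfolding proj_class_def by blast
qed

lemma Vspace_scale:
  assumes "k \<noteq> 0"
  shows "Vspace e (k *s u) = Vspace e u"
proof -
  have 1: "wedge (k *s u) v = wedge u (k *s v)" and
    2: "wedge u v = wedge (k *s u) ((1 / k) *s v)" for v
    using assms by (simp_all add: wedge_def vec_eq_iff)
  show ?thesis unfolding Vspace_def by (intro Collect_cong) (metis 1 2)
qed

lemma homogeneous_expansion:
  "u = u $ 0 *s vbasis 0 + u $ 1 *s vbasis 1 + u $ 2 *s vbasis 2 + u $ 3 *s vbasis 3"
  by (simp add: vec_eq_iff all_4 vbasis_def axis_def)

text \<open>Representatives of a point differ by a nonzero scalar, so a nonzero coordinate 0 can be
  divided out, while a zero one stays zero.\<close>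

lemma affine_points_eq: "{hpoint 1 a b c | a b c. True} = CP3 - face0"
proof (intro equalityI subsetI)
  fix p assume "p \<in> {hpoint 1 a b c | a b c. True}"
  then obtain a b c where p: "p = proj_class (affine_point a b c)"
    by (auto simp: hpoint_affine)
  have "p \<notin> face0"
  proof
    assume "p \<in> face0"
    then obtain z1 z2 z3 where
      "p = proj_class (0 *s vbasis 0 + z1 *s vbasis 1 + z2 *s vbasis 2 + z3 *s vbasis 3)"
      by (auto simp: face0_def hpoint_def)
    then obtain k where "affine_point a b c =
        k *s (0 *s vbasis 0 + z1 *s vbasis 1 + z2 *s vbasis 2 + z3 *s vbasis 3)"
      using p proj_class_eqD by blast
    from arg_cong[OF this, of "\<lambda>u. u $ 0"] show False
      by (simp add: vbasis_def axis_def)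
  qed
  then show "p \<in> CP3 - face0"
    using p affine_point_nonzero by (auto simp: CP3_def)
next
  fix p assume "p \<in> CP3 - face0"
  then obtain u where u: "u \<noteq> 0" "p = proj_class u" "p \<notin> face0"
    by (auto simp: CP3_def)
  have p: "p = hpoint (u $ 0) (u $ 1) (u $ 2) (u $ 3)"
    unfolding hpoint_def u(2) by (subst homogeneous_expansion[of u]) simp
  have "\<not> (\<forall>i. u $ i = 0)" using u(1) by (simp add: vec_eq_iff)
  then have "(u $ 0, u $ 1, u $ 2, u $ 3) \<noteq> (0, 0, 0, 0)"
    by (simp add: all_4)
  then have u0: "u $ 0 \<noteq> 0"
    using p u(3) unfolding face0_def by blast
  have "u = u $ 0 *s affine_point (u $ 1 / u $ 0) (u $ 2 / u $ 0) (u $ 3 / u $ 0)"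
    using u0 by (simp add: vec_eq_iff all_4)
  then have "p = hpoint 1 (u $ 1 / u $ 0) (u $ 2 / u $ 0) (u $ 3 / u $ 0)"
    unfolding u(2) hpoint_affine using proj_class_scale[OF u0] by metis
  then show "p \<in> {hpoint 1 a b c | a b c. True}" by blast
qed

context
  fixes e :: "6 \<Rightarrow> 'a::euclidean_space"
  assumes frame: "orthonormal_frame e"
begin

section \<open>The correspondence over the affine chart\<close>

lemma corresponds_acs_abc: "corresponds e (acs_abc e a b c) (hpoint 1 a b c)"
  unfolding corresponds_def hpoint_affine
  using covectors10_acs_abc[OF frame] affine_point_nonzero by blast

text \<open>Uniqueness holds because a structure is determined by its (1,0)-covectors, and
  \<open>Vspace\<close> depends only on the class of \<open>u\<close>.\<close>

lemma acs_of_point_affine: "acs_of_point e (hpoint 1 a b c) = acs_abc e a b c"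
  unfolding acs_of_point_def
proof (rule the_equality)
  show "acs_abc e a b c \<in> acs_space e \<and> corresponds e (acs_abc e a b c) (hpoint 1 a b c)"
    by (simp add: acs_abc_in_acs_space[OF frame] corresponds_acs_abc)
next
  fix I assume I: "I \<in> acs_space e \<and> corresponds e I (hpoint 1 a b c)"
  then obtain u where u: "proj_class u = proj_class (affine_point a b c)"
    "covectors10 I = Vspace e u"
    by (auto simp: corresponds_def hpoint_affine)
  then have "covectors10 I = covectors10 (acs_abc e a b c)"
    using proj_class_eqD[OF u(1)] by (auto simp: covectors10_acs_abc[OF frame] Vspace_scale)
  then show "I = acs_abc e a b c"
    using I acs_spaceD[OF frame] by (intro covectors10_determines_acs[OF frame]) auto
qed

text \<open>Uniqueness holds because any \<open>u\<close> with the same \<open>Vspace\<close> is a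
  multiple of \<open>affine_point a b c\<close>, with a nonzero factor since \<open>u\<close> is
  nonzero.\<close>

lemma point_of_acs_abc: "point_of_acs e (acs_abc e a b c) = hpoint 1 a b c"
  unfolding point_of_acs_def
proof (rule the_equality)
  show "hpoint 1 a b c \<in> CP3 \<and> corresponds e (acs_abc e a b c) (hpoint 1 a b c)"
    using affine_points_eq corresponds_acs_abc by blast
next
  fix p assume "p \<in> CP3 \<and> corresponds e (acs_abc e a b c) p"
  then obtain u where u: "u \<noteq> 0" "p = proj_class u" "Vspace e (affine_point a b c) = Vspace e u"
    by (auto simp: corresponds_def covectors10_acs_abc[OF frame])
  have eq: "u = (u $ 0) *s affine_point a b c"
    using u(3) affine_point_nth(1) by (intro Vspace_subset_imp_parallel[OF frame]) auto
  with u(1) have "u $ 0 \<noteq> 0" by (metis vector_smult_lzero)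
  then show "p = hpoint 1 a b c"
    unfolding u(2) hpoint_affine using eq proj_class_scale by metis
qed

section \<open>Matrix entries and their inversion\<close>

lemma cxcoord_frame:
  "cxcoord e 1 (e 1) = 1" "cxcoord e 2 (e 1) = 0" "cxcoord e 3 (e 1) = 0"
  "cxcoord e 1 (e 2) = 0" "cxcoord e 2 (e 2) = 1" "cxcoord e 3 (e 2) = 0"
  "cxcoord e 1 (e 3) = 0" "cxcoord e 2 (e 3) = 0" "cxcoord e 3 (e 3) = 1"
  "cxcoord e 1 (e 4) = \<i>" "cxcoord e 2 (e 4) = 0" "cxcoord e 3 (e 4) = 0"
  "cxcoord e 1 (e 5) = 0" "cxcoord e 2 (e 5) = \<i>" "cxcoord e 3 (e 5) = 0"
  by (simp_all add: cxcoord_def frame_inner[OF frame] complex_eq_iff)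

text \<open>These coordinates carry all entries above the diagonal: column j is the real part of
  coordinate j for j up to 3, and the imaginary part of coordinate j - 3 beyond. Writing
  \<open>r\<close> for 2 / x keeps the identities polynomial.\<close>

lemma cxcoord_acs_abc:
  assumes x: "x = 1 + (cmod a)\<^sup>2 + (cmod b)\<^sup>2 + (cmod c)\<^sup>2" and r: "r = 2 / x"
  shows "cxcoord e 1 (acs_abc e a b c (e 1)) = \<i> * of_real (1 - r * ((cmod b)\<^sup>2 + (cmod c)\<^sup>2))"
    "cxcoord e 2 (acs_abc e a b c (e 1)) = \<i> * of_real r * (a * cnj b - c)"
    "cxcoord e 3 (acs_abc e a b c (e 1)) = \<i> * of_real r * (a * cnj c + b)"
    "cxcoord e 2 (acs_abc e a b c (e 2)) = \<i> * of_real (1 - r * ((cmod a)\<^sup>2 + (cmod c)\<^sup>2))"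
    "cxcoord e 3 (acs_abc e a b c (e 2)) = \<i> * of_real r * (b * cnj c - a)"
    "cxcoord e 1 (acs_abc e a b c (e 2)) = \<i> * of_real r * (b * cnj a + c)"
    "cxcoord e 3 (acs_abc e a b c (e 3)) = \<i> * of_real (1 - r * ((cmod a)\<^sup>2 + (cmod b)\<^sup>2))"
    "cxcoord e 1 (acs_abc e a b c (e 3)) = \<i> * of_real r * (c * cnj a - b)"
    "cxcoord e 2 (acs_abc e a b c (e 3)) = \<i> * of_real r * (c * cnj b + a)"
    "cxcoord e 2 (acs_abc e a b c (e 4)) = of_real r * (- (a * cnj b) - c)"
    "cxcoord e 3 (acs_abc e a b c (e 4)) = of_real r * (- (a * cnj c) + b)"
    "cxcoord e 3 (acs_abc e a b c (e 5)) = of_real r * (- (b * cnj c) - a)"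
proof -
  have "- 2 / x = - r" by (simp add: r)
  note eqs = acs_abc_eq[OF x, unfolded this, folded r] cxcoord_std_acs[OF frame] quad_op_def
    cxcoord_linear_simps cxcoord_cross_op[OF frame] cxcoord_frame
  show "cxcoord e 1 (acs_abc e a b c (e 1)) = \<i> * of_real (1 - r * ((cmod b)\<^sup>2 + (cmod c)\<^sup>2))"
    "cxcoord e 2 (acs_abc e a b c (e 1)) = \<i> * of_real r * (a * cnj b - c)"
    "cxcoord e 3 (acs_abc e a b c (e 1)) = \<i> * of_real r * (a * cnj c + b)"
    "cxcoord e 2 (acs_abc e a b c (e 2)) = \<i> * of_real (1 - r * ((cmod a)\<^sup>2 + (cmod c)\<^sup>2))"
    "cxcoord e 3 (acs_abc e a b c (e 2)) = \<i> * of_real r * (b * cnj c - a)"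
    "cxcoord e 1 (acs_abc e a b c (e 2)) = \<i> * of_real r * (b * cnj a + c)"
    "cxcoord e 3 (acs_abc e a b c (e 3)) = \<i> * of_real (1 - r * ((cmod a)\<^sup>2 + (cmod b)\<^sup>2))"
    "cxcoord e 1 (acs_abc e a b c (e 3)) = \<i> * of_real r * (c * cnj a - b)"
    "cxcoord e 2 (acs_abc e a b c (e 3)) = \<i> * of_real r * (c * cnj b + a)"
    "cxcoord e 2 (acs_abc e a b c (e 4)) = of_real r * (- (a * cnj b) - c)"
    "cxcoord e 3 (acs_abc e a b c (e 4)) = of_real r * (- (a * cnj c) + b)"
    "cxcoord e 3 (acs_abc e a b c (e 5)) = of_real r * (- (b * cnj c) - a)"
    unfolding eqs by (simp_all add: complex_norm_square algebra_simps del: of_real_power)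
qed

lemma acs_entry_skew:
  assumes "I \<in> acs_space e"
  shows "acs_entry e I j i = - acs_entry e I i j"
proof -
  note I = acs_spaceD[OF frame assms]
  have "I (e j) \<bullet> e i = I (I (e j)) \<bullet> I (e i)" by (simp only: I(2))
  then show ?thesis by (simp add: acs_entry_def I(3) inner_commute)
qed

lemma acs_entry_acs_abc:
  assumes x: "x = 1 + (cmod a)\<^sup>2 + (cmod b)\<^sup>2 + (cmod c)\<^sup>2"
    and M: "M = acs_entry e (acs_abc e a b c)"
  shows "M 1 2 = 2 / x * Im (cnj a * b + c)" and
    "M 1 3 = 2 / x * Im (cnj a * c - b)" and
    "M 2 3 = 2 / x * Im (cnj b * c + a)" and
    "M 1 4 = 1 / x * (x - 2 * (cmod b)\<^sup>2 - 2 * (cmod c)\<^sup>2)" and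
    "M 1 5 = 2 / x * Re (cnj a * b - c)" and
    "M 1 6 = 2 / x * Re (cnj a * c + b)" and
    "M 2 4 = 2 / x * Re (cnj a * b + c)" and
    "M 2 5 = 1 / x * (x - 2 * (cmod a)\<^sup>2 - 2 * (cmod c)\<^sup>2)" and
    "M 2 6 = 2 / x * Re (cnj b * c - a)" and
    "M 3 4 = 2 / x * Re (cnj a * c - b)" and
    "M 3 5 = 2 / x * Re (cnj b * c + a)" and
    "M 3 6 = 1 / x * (x - 2 * (cmod a)\<^sup>2 - 2 * (cmod b)\<^sup>2)" and
    "M 4 5 = 2 / x * Im (cnj a * b - c)" and
    "M 4 6 = 2 / x * Im (cnj a * c + b)" and
    "M 5 6 = 2 / x * Im (cnj b * c - a)"
proof -
  have "acs_entry e I i 2 = Re (cxcoord e 2 (I (e i)))"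
    "acs_entry e I i 3 = Re (cxcoord e 3 (I (e i)))"
    "acs_entry e I i 4 = Im (cxcoord e 1 (I (e i)))"
    "acs_entry e I i 5 = Im (cxcoord e 2 (I (e i)))"
    "acs_entry e I i 6 = Im (cxcoord e 3 (I (e i)))" for I i
    by (simp_all add: acs_entry_def cxcoord_def)
  note entries = M this cxcoord_acs_abc[OF x refl]
  have diag: "1 / x * (x - 2 * p - 2 * q) = 1 - 2 / x * (p + q)" for p q
    using scale_factor_pos[OF x] by (simp add: field_simps)
  show "M 1 2 = 2 / x * Im (cnj a * b + c)" and
    "M 1 3 = 2 / x * Im (cnj a * c - b)" and
    "M 2 3 = 2 / x * Im (cnj b * c + a)" and
    "M 1 4 = 1 / x * (x - 2 * (cmod b)\<^sup>2 - 2 * (cmod c)\<^sup>2)" and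
    "M 1 5 = 2 / x * Re (cnj a * b - c)" and
    "M 1 6 = 2 / x * Re (cnj a * c + b)" and
    "M 2 4 = 2 / x * Re (cnj a * b + c)" and
    "M 2 5 = 1 / x * (x - 2 * (cmod a)\<^sup>2 - 2 * (cmod c)\<^sup>2)" and
    "M 2 6 = 2 / x * Re (cnj b * c - a)" and
    "M 3 4 = 2 / x * Re (cnj a * c - b)" and
    "M 3 5 = 2 / x * Re (cnj b * c + a)" and
    "M 3 6 = 1 / x * (x - 2 * (cmod a)\<^sup>2 - 2 * (cmod b)\<^sup>2)" and
    "M 4 5 = 2 / x * Im (cnj a * b - c)" and
    "M 4 6 = 2 / x * Im (cnj a * c + b)" and
    "M 5 6 = 2 / x * Im (cnj b * c - a)"
    unfolding entries diag by simp_all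
qed

text \<open>In each difference of entries the quadratic terms cancel, which leaves 4 / x times the
  real or imaginary part of a coordinate. The denominator is 4 - 4 (x - 1) / x = 4 / x.\<close>

lemma affine_coordinates_from_entries:
  assumes M: "M = acs_entry e (acs_abc e a b c)"
  defines "N \<equiv> complex_of_real (1 + M 1 4 + M 2 5 + M 3 6)"
  shows "(complex_of_real (M 3 5 - M 2 6) + \<i> * complex_of_real (M 2 3 - M 5 6)) / N = a"
    "(complex_of_real (M 1 6 - M 3 4) + \<i> * complex_of_real (M 4 6 - M 1 3)) / N = b"
    "(complex_of_real (M 2 4 - M 1 5) + \<i> * complex_of_real (M 1 2 - M 4 5)) / N = c"
proof -
  define x where "x = 1 + (cmod a)\<^sup>2 + (cmod b)\<^sup>2 + (cmod c)\<^sup>2"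
  note entries = acs_entry_acs_abc[OF x_def M]
  have x: "x \<noteq> 0" using scale_factor_pos[OF x_def] by simp
  have "1 + M 1 4 + M 2 5 + M 3 6 = 4 / x"
  proof -
    have "1 + M 1 4 + M 2 5 + M 3 6 =
        4 - 4 * ((cmod a)\<^sup>2 + (cmod b)\<^sup>2 + (cmod c)\<^sup>2) / x"
      unfolding entries using x by (simp add: diff_divide_distrib add_divide_distrib algebra_simps)
    also have "(cmod a)\<^sup>2 + (cmod b)\<^sup>2 + (cmod c)\<^sup>2 = x - 1"
      by (simp add: x_def)
    finally show ?thesis using x by (simp add: field_simps)
  qed
  then have N: "N = of_real (4 / x)" by (simp only: N_def)
  have eq: "(complex_of_real p + \<i> * complex_of_real q) / N = z"
    if "p = 4 / x * Re z" "q = 4 / x * Im z" for p q z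
    unfolding N that using x by (simp add: complex_eq_iff)
  show "(complex_of_real (M 3 5 - M 2 6) + \<i> * complex_of_real (M 2 3 - M 5 6)) / N = a"
    by (rule eq; unfold entries; simp add: algebra_simps)
  show "(complex_of_real (M 1 6 - M 3 4) + \<i> * complex_of_real (M 4 6 - M 1 3)) / N = b"
    by (rule eq; unfold entries; simp add: algebra_simps)
  show "(complex_of_real (M 2 4 - M 1 5) + \<i> * complex_of_real (M 1 2 - M 4 5)) / N = c"
    by (rule eq; unfold entries; simp add: algebra_simps)
qed

end

theorem theorem1:
  fixes br :: "'a::euclidean_space \<Rightarrow> 'a \<Rightarrow> 'a" and e :: "6 \<Rightarrow> 'a"
  assumes "DIM('a) = 6" and "lie_bracket br" and "orthonormal_frame e"
  shows
    "{hpoint 1 a b c | a b c. True} = CP3 - face0 \<and>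
     (\<forall>(a::complex) (b::complex) (c::complex) (x::real) (I::'a \<Rightarrow> 'a) (M::6 \<Rightarrow> 6 \<Rightarrow> real).
        x = 1 + (cmod a)\<^sup>2 + (cmod b)\<^sup>2 + (cmod c)\<^sup>2 \<longrightarrow>
        I = acs_of_point e (hpoint 1 a b c) \<longrightarrow>
        M = acs_entry e I \<longrightarrow>
          I \<in> acs_space e \<and> corresponds e I (hpoint 1 a b c) \<and> I \<in> acs_nbhd e \<and>
          M 1 2 = 2 / x * Im (cnj a * b + c) \<and>
          M 1 3 = 2 / x * Im (cnj a * c - b) \<and>
          M 2 3 = 2 / x * Im (cnj b * c + a) \<and>
          M 1 4 = 1 / x * (x - 2 * (cmod b)\<^sup>2 - 2 * (cmod c)\<^sup>2) \<and>
          M 1 5 = 2 / x * Re (cnj a * b - c) \<and>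
          M 1 6 = 2 / x * Re (cnj a * c + b) \<and>
          M 2 4 = 2 / x * Re (cnj a * b + c) \<and>
          M 2 5 = 1 / x * (x - 2 * (cmod a)\<^sup>2 - 2 * (cmod c)\<^sup>2) \<and>
          M 2 6 = 2 / x * Re (cnj b * c - a) \<and>
          M 3 4 = 2 / x * Re (cnj a * c - b) \<and>
          M 3 5 = 2 / x * Re (cnj b * c + a) \<and>
          M 3 6 = 1 / x * (x - 2 * (cmod a)\<^sup>2 - 2 * (cmod b)\<^sup>2) \<and>
          M 4 5 = 2 / x * Im (cnj a * b - c) \<and>
          M 4 6 = 2 / x * Im (cnj a * c + b) \<and>
          M 5 6 = 2 / x * Im (cnj b * c - a) \<and>
          (\<forall>i j. M j i = - M i j) \<and> (\<forall>i. M i i = 0)) \<and>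
     (\<forall>(I::'a \<Rightarrow> 'a) (M::6 \<Rightarrow> 6 \<Rightarrow> real) (a::complex) (b::complex) (c::complex).
        I \<in> acs_nbhd e \<longrightarrow>
        M = acs_entry e I \<longrightarrow>
        a = (complex_of_real (M 3 5 - M 2 6) + \<i> * complex_of_real (M 2 3 - M 5 6))
              / complex_of_real (1 + M 1 4 + M 2 5 + M 3 6) \<longrightarrow>
        b = (complex_of_real (M 1 6 - M 3 4) + \<i> * complex_of_real (M 4 6 - M 1 3))
              / complex_of_real (1 + M 1 4 + M 2 5 + M 3 6) \<longrightarrow>
        c = (complex_of_real (M 2 4 - M 1 5) + \<i> * complex_of_real (M 1 2 - M 4 5))
              / complex_of_real (1 + M 1 4 + M 2 5 + M 3 6) \<longrightarrow>
          corresponds e I (hpoint 1 a b c) \<and> point_of_acs e I = hpoint 1 a b c)"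
proof (rule conjI[OF affine_points_eq], (rule conjI; intro allI impI), goal_cases)
  case (1 a b c x I M)
  then have I: "I = acs_abc e a b c" and M: "M = acs_entry e (acs_abc e a b c)"
    by (simp_all add: acs_of_point_affine[OF assms(3)])
  have acs: "I \<in> acs_space e" "I \<in> acs_nbhd e" "corresponds e I (hpoint 1 a b c)"
    unfolding I using acs_abc_in_acs_space acs_abc_in_acs_nbhd corresponds_acs_abc assms(3)
    by blast+
  have skew: "M j i = - M i j" for i j
    using acs_entry_skew[OF assms(3) acs(1)] 1(3) by blast
  from this[of i i for i] have diag: "M i i = 0" for i by simp
  show ?case
    using acs acs_entry_acs_abc[OF assms(3) 1(1) M] skew diag by blast
next
  case (2 I M a b c)
  \<comment> \<open>Some affine coordinates exist; the inversion formulas then identify them with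
    the given quotients.\<close>
  obtain a' b' c' where I: "I = acs_abc e a' b' c'"
    using acs_nbhd_eq_acs_abc[OF assms(3) 2(1)] by blast
  note coords = affine_coordinates_from_entries[OF assms(3) 2(2)[unfolded I]]
  have "a = a'" "b = b'" "c = c'"
    using 2(3-5) coords by simp_all
  then show ?case
    by (simp add: I corresponds_acs_abc[OF assms(3)] point_of_acs_abc[OF assms(3)])
qed

end
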